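(* Let $a,b>0$ be such that there is a nondegenerate triangle with side lengths $1,a,b$, and assume $(a,b)\ne(1,1)$. Let $\Delta_{ab}$ denote a triangle with side lengths $1,a,b$ in the anti-clockwise order (so $\Delta_{ba}$ is a triangle with side lengths $1,b,a$ in the anti-clockwise order). Then, for $q\in\mathbb{R}$, $[T_q(\Delta_{ab})]=[\Delta_{ba}]$ if and only if $$q=\frac{b^2-1}{a^2+b^2-2},\quad q=\frac{1-a^2}{b^2+1-2a^2},\quad\text{or}\quad q=\frac{a^2-b^2}{1+a^2-2b^2},$$ where any of these expressions whose denominator vanishes is omitted.
   Context: Triangles are nondegenerate triangles in the Euclidean plane $\cong\mathbb{C}$. Two triangles are called similar if some orientation-preserving similarity of the plane carries one onto the other (labels of vertices need not be matched); $[\Delta]$ denotes the similarity class of $\Delta$. Equisection operators: for $q\in\mathbb{R}$ and a triangle $\triangle ABC$ with vertices $A,B,C$ listed anticlockwise, $T_q(\triangle ABC)=\triangle A'B'C'$ where $A'=qB+(1-q)C$, $B'=qC+(1-q)A$, $C'=qA+(1-q)B$. (A cyclic relabelling of the vertices does not change the resulting triangle.) *)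

theory Defs
  imports "HOL-Analysis.Analysis"
begin

definition is_triangle :: "complex set \<Rightarrow> bool" where
  "is_triangle D \<longleftrightarrow> (\<exists>A B C. \<not> collinear {A, B, C} \<and> D = convex hull {A, B, C})"

text \<open>The imaginary part is twice the signed area of the triangle, so this also entails
  nondegeneracy.\<close>

definition anticlockwise :: "complex \<Rightarrow> complex \<Rightarrow> complex \<Rightarrow> bool" where
  "anticlockwise A B C \<longleftrightarrow> 0 < Im (cnj (B - A) * (C - A))"

definition orientation_preserving_similarity :: "(complex \<Rightarrow> complex) \<Rightarrow> bool" where
  "orientation_preserving_similarity f \<longleftrightarrow> (\<exists>\<alpha> \<beta>. \<alpha> \<noteq> 0 \<and> f = (\<lambda>z. \<alpha> * z + \<beta>))"

definition similar :: "complex set \<Rightarrow> complex set \<Rightarrow> bool" where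
  "similar D D' \<longleftrightarrow> (\<exists>f. orientation_preserving_similarity f \<and> f ` D = D')"

definition similarity_class :: "complex set \<Rightarrow> complex set set" where
  "similarity_class D = {D'. is_triangle D' \<and> similar D D'}"

definition side_lengths_anticlockwise ::
    "complex set \<Rightarrow> real \<Rightarrow> real \<Rightarrow> real \<Rightarrow> bool" where
  "side_lengths_anticlockwise D x y z \<longleftrightarrow>
     (\<exists>A B C. anticlockwise A B C \<and> D = convex hull {A, B, C} \<and>
        dist A B = x \<and> dist B C = y \<and> dist C A = z)"

text \<open>The description is proper on triangles: the three anticlockwise listings of the
  vertices differ by a cyclic relabelling and give the same result; see
  \<open>equisection_convex_hull\<close> below.\<close>

definition equisection :: "real \<Rightarrow> complex set \<Rightarrow> complex set" where
  "equisection q D =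
     (THE D'. \<exists>A B C. anticlockwise A B C \<and> D = convex hull {A, B, C} \<and>
        D' = convex hull {q *\<^sub>R B + (1 - q) *\<^sub>R C,
                          q *\<^sub>R C + (1 - q) *\<^sub>R A,
                          q *\<^sub>R A + (1 - q) *\<^sub>R B})"

lemma anticlockwise_not_collinear:
  assumes "anticlockwise A B C"
  shows "\<not> collinear {A, B, C}"
proof
  assume "collinear {A, B, C}"
  then have "collinear {B, A, C}" by (simp add: insert_commute)
  then have "collinear {0, B - A, C - A}" by (simp add: collinear_3)
  then consider "B - A = 0" | "C - A = 0" | c where "C - A = c *\<^sub>R (B - A)"
    by (auto simp: collinear_lemma)
  then have "Im (cnj (B - A) * (C - A)) = 0"
  proof cases
    case 3
    then show ?thesis by (simp only: 3) (simp add: algebra_simps)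
  qed auto
  with assms show False by (simp add: anticlockwise_def)
qed

lemma anticlockwise_is_triangle:
  "anticlockwise A B C \<Longrightarrow> is_triangle (convex hull {A, B, C})"
  unfolding is_triangle_def using anticlockwise_not_collinear by blast

lemma not_collinear_anticlockwise:
  assumes "\<not> collinear {A, B, C}"
  shows "anticlockwise A B C \<or> anticlockwise A C B"
proof (rule ccontr)
  assume "\<not> ?thesis"
  then have z: "Im (cnj (B - A) * (C - A)) = 0"
    by (simp add: anticlockwise_def algebra_simps)
  have "A \<noteq> B" using assms by auto
  then have n: "(Re (B - A))\<^sup>2 + (Im (B - A))\<^sup>2 \<noteq> 0"
    by (auto simp: complex_eq_iff sum_power2_eq_zero_iff)
  define c where "c = Re (cnj (B - A) * (C - A)) / ((Re (B - A))\<^sup>2 + (Im (B - A))\<^sup>2)"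
  have "cnj (B - A) * (C - A) = of_real (Re (cnj (B - A) * (C - A)))"
    using z by (simp add: complex_eq_iff)
  then have "(B - A) * cnj (B - A) * (C - A) =
      (B - A) * of_real (Re (cnj (B - A) * (C - A)))"
    by (simp add: mult.assoc)
  moreover have "(B - A) * cnj (B - A) = of_real ((Re (B - A))\<^sup>2 + (Im (B - A))\<^sup>2)"
    by (rule complex_mult_cnj)
  ultimately have "C - A = c *\<^sub>R (B - A)"
    using n unfolding c_def scaleR_conv_of_real of_real_divide
    by (metis (no_types, lifting) mult.commute nonzero_eq_divide_eq of_real_eq_0_iff
        times_divide_eq_left)
  then have "collinear {0, B - A, C - A}" by (auto simp: collinear_lemma)
  then have "collinear {B, A, C}" by (simp add: collinear_3)
  with assms show False by (simp add: insert_commute)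
qed

lemma is_triangle_iff_anticlockwise:
  "is_triangle D \<longleftrightarrow> (\<exists>A B C. anticlockwise A B C \<and> D = convex hull {A, B, C})"
  by (metis is_triangle_def anticlockwise_is_triangle not_collinear_anticlockwise insert_commute)

lemma anticlockwise_convex_hull_eq:
  assumes "anticlockwise A B C" "anticlockwise A' B' C'"
    and "convex hull {A, B, C} = convex hull {A', B', C'}"
  shows "(A', B', C') \<in> {(A, B, C), (B, C, A), (C, A, B)}"
proof -
  have "\<not> affine_dependent {A, B, C}" "\<not> affine_dependent {A', B', C'}"
    using assms anticlockwise_not_collinear affine_dependent_imp_collinear_3 by blast+
  then have "{A, B, C} = {A', B', C'}"
    using extreme_point_of_convex_hull_affine_independent assms(3) by (metis subsetI subset_antisym)
  then have "A' \<in> {A, B, C}" "B' \<in> {A, B, C}" "C' \<in> {A, B, C}" by auto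
  then show ?thesis
    using assms(1,2) by (auto simp: anticlockwise_def algebra_simps)
qed

lemma equisection_convex_hull:
  assumes "anticlockwise A B C"
  shows "equisection q (convex hull {A, B, C}) =
    convex hull {q *\<^sub>R B + (1 - q) *\<^sub>R C, q *\<^sub>R C + (1 - q) *\<^sub>R A, q *\<^sub>R A + (1 - q) *\<^sub>R B}"
  unfolding equisection_def
proof (rule the_equality)
  show "\<exists>A' B' C'. anticlockwise A' B' C' \<and> convex hull {A, B, C} = convex hull {A', B', C'} \<and>
      convex hull {q *\<^sub>R B + (1 - q) *\<^sub>R C, q *\<^sub>R C + (1 - q) *\<^sub>R A, q *\<^sub>R A + (1 - q) *\<^sub>R B} =
      convex hull {q *\<^sub>R B' + (1 - q) *\<^sub>R C', q *\<^sub>R C' + (1 - q) *\<^sub>R A', q *\<^sub>R A' + (1 - q) *\<^sub>R B'}"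
    using assms by blast
next
  fix D'
  assume "\<exists>A' B' C'. anticlockwise A' B' C' \<and> convex hull {A, B, C} = convex hull {A', B', C'} \<and>
      D' = convex hull {q *\<^sub>R B' + (1 - q) *\<^sub>R C', q *\<^sub>R C' + (1 - q) *\<^sub>R A', q *\<^sub>R A' + (1 - q) *\<^sub>R B'}"
  then obtain A' B' C' where *: "anticlockwise A' B' C'"
      "convex hull {A, B, C} = convex hull {A', B', C'}"
      "D' = convex hull {q *\<^sub>R B' + (1 - q) *\<^sub>R C', q *\<^sub>R C' + (1 - q) *\<^sub>R A', q *\<^sub>R A' + (1 - q) *\<^sub>R B'}"
    by blast
  from anticlockwise_convex_hull_eq[OF assms *(1,2)] *(3)
  show "D' = convex hull {q *\<^sub>R B + (1 - q) *\<^sub>R C, q *\<^sub>R C + (1 - q) *\<^sub>R A, q *\<^sub>R A + (1 - q) *\<^sub>R B}"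
    by (auto simp: insert_commute)
qed

lemma anticlockwise_equisection:
  assumes "anticlockwise A B C"
  shows "anticlockwise (q *\<^sub>R B + (1 - q) *\<^sub>R C) (q *\<^sub>R C + (1 - q) *\<^sub>R A) (q *\<^sub>R A + (1 - q) *\<^sub>R B)"
proof -
  have "(q - 1/2)\<^sup>2 \<ge> 0" by simp
  then have "1 - 3 * q + 3 * q\<^sup>2 > 0" by (simp add: power2_eq_square algebra_simps)
  then have "(1 - 3 * q + 3 * q\<^sup>2) * Im (cnj (B - A) * (C - A)) > 0"
    using assms by (simp add: anticlockwise_def)
  also have "(1 - 3 * q + 3 * q\<^sup>2) * Im (cnj (B - A) * (C - A)) =
    Im (cnj (q *\<^sub>R C + (1 - q) *\<^sub>R A - (q *\<^sub>R B + (1 - q) *\<^sub>R C)) *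
        (q *\<^sub>R A + (1 - q) *\<^sub>R B - (q *\<^sub>R B + (1 - q) *\<^sub>R C)))"
    by (simp add: power2_eq_square algebra_simps)
  finally show ?thesis by (simp add: anticlockwise_def)
qed

lemma is_triangle_equisection: "is_triangle D \<Longrightarrow> is_triangle (equisection q D)"
  by (metis is_triangle_iff_anticlockwise equisection_convex_hull anticlockwise_equisection)

lemma side_lengths_anticlockwise_mirror:
  assumes "side_lengths_anticlockwise D x y z"
  shows "\<exists>D'. side_lengths_anticlockwise D' x z y"
proof -
  obtain A B C where *: "anticlockwise A B C" "dist A B = x" "dist B C = y" "dist C A = z"
    using assms unfolding side_lengths_anticlockwise_def by blast
  have "anticlockwise (cnj B) (cnj A) (cnj C)"
    using *(1) by (simp add: anticlockwise_def algebra_simps)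
  moreover have "dist (cnj u) (cnj v) = dist u v" for u v
    by (metis complex_cnj_diff complex_mod_cnj dist_norm)
  ultimately show ?thesis
    using *(2-) unfolding side_lengths_anticlockwise_def by (metis dist_commute)
qed

end

theory Submission
  imports Defs
begin

text \<open>Let \<open>k = 1 - 3q + 3q\<^sup>2\<close>. The squared side lengths of \<open>T\<^sub>q \<Delta>\<close> are quadratic polynomials in \<open>q\<close> with
  sum \<open>k\<close> times the sum for \<open>\<Delta>\<close>, so \<open>T\<^sub>q \<Delta>\<^sub>a\<^sub>b\<close> is similar to \<open>\<Delta>\<^sub>b\<^sub>a\<close> iff they are \<open>k\<close> times a cyclic
  shift of \<open>(1, b\<^sup>2, a\<^sup>2)\<close>. For each of the three shifts, the three differences are the products of
  \<open>2q - 1\<close>, \<open>1 - q\<close> and \<open>-q\<close>, in some order, with one and the same factor linear in \<open>q\<close>, and the root of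
  this factor is the corresponding expression of the statement.\<close>

lemma similar_refl: "similar D D"
  unfolding similar_def orientation_preserving_similarity_def
  by (rule exI[of _ "\<lambda>z. 1 * z + 0"]) (simp only: image_ident mult_1 add_0_right,
      metis mult_1 add_0_right zero_neq_one)

lemma similar_sym:
  assumes "similar D D'"
  shows "similar D' D"
proof -
  obtain \<alpha> \<beta> where *: "\<alpha> \<noteq> 0" "D' = (\<lambda>z. \<alpha> * z + \<beta>) ` D"
    using assms unfolding similar_def orientation_preserving_similarity_def by blast
  have "(\<lambda>z. inverse \<alpha> * z + - \<beta> / \<alpha>) ` D' = D"
    using *(1) unfolding *(2) image_image by (simp add: field_simps)
  moreover have "inverse \<alpha> \<noteq> 0" using *(1) by simp
  ultimately show ?thesis
    unfolding similar_def orientation_preserving_similarity_def by blast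
qed

lemma similar_trans:
  assumes "similar D D'" "similar D' D''"
  shows "similar D D''"
proof -
  obtain \<alpha> \<beta> \<gamma> \<delta> where *: "\<alpha> \<noteq> 0" "D' = (\<lambda>z. \<alpha> * z + \<beta>) ` D" "\<gamma> \<noteq> 0"
    "D'' = (\<lambda>z. \<gamma> * z + \<delta>) ` D'"
    using assms unfolding similar_def orientation_preserving_similarity_def by blast
  have "D'' = (\<lambda>z. (\<gamma> * \<alpha>) * z + (\<gamma> * \<beta> + \<delta>)) ` D"
    unfolding *(2,4) image_image by (simp add: algebra_simps)
  moreover have "\<gamma> * \<alpha> \<noteq> 0" using * by simp
  ultimately show ?thesis
    unfolding similar_def orientation_preserving_similarity_def by blast
qed

text \<open>Reflexivity puts the triangle \<open>D'\<close> in its own class, so equality of the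
  classes yields \<open>similar D D'\<close>; the converse is symmetry and transitivity.\<close>

lemma similarity_class_eq_iff:
  assumes "is_triangle D'"
  shows "similarity_class D = similarity_class D' \<longleftrightarrow> similar D D'"
  using assms similar_refl similar_sym similar_trans unfolding similarity_class_def by blast

lemma similarity_image_convex_hull:
  fixes \<alpha> \<beta> :: complex
  shows "(\<lambda>z. \<alpha> * z + \<beta>) ` (convex hull S) = convex hull ((\<lambda>z. \<alpha> * z + \<beta>) ` S)"
proof -
  have "(\<lambda>z. \<alpha> * z + \<beta>) ` T = (\<lambda>z. \<beta> + z) ` (((*) \<alpha>) ` T)" for T
    by (simp add: image_image add.commute)
  moreover have "linear ((*) \<alpha>)" by (simp add: bounded_linear.linear bounded_linear_mult_right)
  ultimately show ?thesis
    by (simp only: convex_hull_translation convex_hull_linear_image)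
qed

text \<open>Law of cosines: \<open>Re (cnj u * v)\<close> is the inner product of \<open>u\<close>
  and \<open>v\<close>.\<close>

lemma cmod_sq_diff:
  "(cmod (v - u))\<^sup>2 = (cmod u)\<^sup>2 + (cmod v)\<^sup>2 - 2 * Re (cnj u * v)"
  unfolding cmod_power2 by (simp add: power2_eq_square algebra_simps)

text \<open>Oriented SSS criterion. The side lengths determine the real part of
  \<open>cnj u * v\<close> and, up to sign, its imaginary part; the common orientation fixes the
  sign. Thus this product scales by \<open>k\<close>, which forces u'/u = v'/v.\<close>

lemma proportional_sides_imp_similarity:
  assumes "anticlockwise A B C" "anticlockwise A' B' C'" and k: "k > 0"
    and AB: "(dist A' B')\<^sup>2 = k * (dist A B)\<^sup>2"
    and BC: "(dist B' C')\<^sup>2 = k * (dist B C)\<^sup>2"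
    and CA: "(dist C' A')\<^sup>2 = k * (dist C A)\<^sup>2"
  obtains \<alpha> \<beta> where "\<alpha> \<noteq> 0" "A' = \<alpha> * A + \<beta>" "B' = \<alpha> * B + \<beta>" "C' = \<alpha> * C + \<beta>"
proof -
  define u v u' v' where uv: "u = B - A" "v = C - A" "u' = B' - A'" "v' = C' - A'"
  have pos: "Im (cnj u * v) > 0" "Im (cnj u' * v') > 0"
    using assms(1,2) by (simp_all add: anticlockwise_def uv)
  then have nz: "u \<noteq> 0" "u' \<noteq> 0" by auto
  have nu: "(cmod u')\<^sup>2 = k * (cmod u)\<^sup>2" and nv: "(cmod v')\<^sup>2 = k * (cmod v)\<^sup>2"
    using AB CA by (simp_all add: uv dist_norm norm_minus_commute)
  have "(cmod (v' - u'))\<^sup>2 = k * (cmod (v - u))\<^sup>2"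
    using BC by (simp add: uv dist_norm norm_minus_commute)
  then have re: "Re (cnj u' * v') = k * Re (cnj u * v)"
    using nu nv unfolding cmod_sq_diff by (simp add: algebra_simps)
  have lagrange: "(Im (cnj x * y))\<^sup>2 = (cmod x)\<^sup>2 * (cmod y)\<^sup>2 - (Re (cnj x * y))\<^sup>2" for x y
    unfolding cmod_power2 by (simp add: power2_eq_square algebra_simps)
  have "(Im (cnj u' * v'))\<^sup>2 = (k * Im (cnj u * v))\<^sup>2"
    unfolding power_mult_distrib lagrange nu nv re by (simp add: power2_eq_square algebra_simps)
  \<comment> \<open>Both imaginary parts are positive, so equality of squares leaves no choice of
    sign.\<close>
  then have im: "Im (cnj u' * v') = k * Im (cnj u * v)"
    using pos k by (smt (verit) mult_pos_pos power2_eq_iff)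
  have prod: "cnj u' * v' = of_real k * (cnj u * v)"
    using re im by (simp add: complex_eq_iff)
  have "u' * cnj u' = of_real k * (u * cnj u)"
    unfolding complex_norm_square[symmetric] nu by simp
  \<comment> \<open>Multiplying \<open>prod\<close> by \<open>u'\<close> makes \<open>cnj u\<close>
    a common factor, which then cancels.\<close>
  with prod have "(of_real k * (u * cnj u)) * v' = (of_real k * (cnj u * v)) * u'"
    by (metis mult.assoc mult.commute)
  then have "(of_real k * cnj u) * (u * v') = (of_real k * cnj u) * (v * u')"
    by (simp add: mult_ac)
  then have uv': "u * v' = v * u'" using k nz by simp
  define \<alpha> where "\<alpha> = u' / u"
  have 1: "u' = \<alpha> * u" "v' = \<alpha> * v" "\<alpha> \<noteq> 0"
    using uv' nz by (simp_all add: \<alpha>_def field_simps)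
  show ?thesis
  proof
    show "\<alpha> \<noteq> 0" by fact
    show "A' = \<alpha> * A + (A' - \<alpha> * A)" by simp
    show "B' = \<alpha> * B + (A' - \<alpha> * A)" "C' = \<alpha> * C + (A' - \<alpha> * A)"
      using 1 by (simp_all add: uv algebra_simps)
  qed
qed

text \<open>The vertices form one triple so that a quantifier can range over cyclic relabellings.
  Squared lengths keep all later conditions polynomial; \<open>k\<close> is the square of the
  similarity ratio.\<close>

definition proportional_sides ::
    "complex \<times> complex \<times> complex \<Rightarrow> real \<Rightarrow> real \<Rightarrow> real \<Rightarrow> bool" where
  "proportional_sides = (\<lambda>(A, B, C) x y z. \<exists>k>0.
     (dist A B)\<^sup>2 = k * x\<^sup>2 \<and> (dist B C)\<^sup>2 = k * y\<^sup>2 \<and> (dist C A)\<^sup>2 = k * z\<^sup>2)"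

text \<open>A similarity sends the vertices to an anticlockwise triple with the target hull, so only
  cyclic relabellings can occur. The converse is the oriented SSS criterion.\<close>

lemma similar_iff_proportional_sides:
  assumes tri: "anticlockwise A B C" and tri': "anticlockwise A' B' C'"
  shows "similar (convex hull {A, B, C}) (convex hull {A', B', C'}) \<longleftrightarrow>
    (\<exists>t \<in> {(A', B', C'), (B', C', A'), (C', A', B')}.
       proportional_sides t (dist A B) (dist B C) (dist C A))"
    (is "?L \<longleftrightarrow> ?R")
proof
  assume ?L
  then obtain \<alpha> \<beta> where \<alpha>: "\<alpha> \<noteq> 0"
    and img: "(\<lambda>z. \<alpha> * z + \<beta>) ` (convex hull {A, B, C}) = convex hull {A', B', C'}"
    unfolding similar_def orientation_preserving_similarity_def by blast
  define f where "f z = \<alpha> * z + \<beta>" for z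
  have d: "(dist (f x) (f y))\<^sup>2 = (cmod \<alpha>)\<^sup>2 * (dist x y)\<^sup>2" for x y
    by (simp add: f_def dist_norm norm_mult power_mult_distrib flip: right_diff_distrib)
  have "cnj (f B - f A) * (f C - f A) = of_real ((cmod \<alpha>)\<^sup>2) * (cnj (B - A) * (C - A))"
    unfolding complex_norm_square f_def by (simp add: algebra_simps)
  then have "Im (cnj (f B - f A) * (f C - f A)) = (cmod \<alpha>)\<^sup>2 * Im (cnj (B - A) * (C - A))"
    by (simp only: times_complex.sel Re_complex_of_real Im_complex_of_real mult_zero_left add_0_right)
  then have "anticlockwise (f A) (f B) (f C)"
    using tri \<alpha> unfolding anticlockwise_def by simp
  moreover have "convex hull {A', B', C'} = convex hull {f A, f B, f C}"
    using img unfolding similarity_image_convex_hull f_def by simp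
  ultimately have "(f A, f B, f C) \<in> {(A', B', C'), (B', C', A'), (C', A', B')}"
    using anticlockwise_convex_hull_eq[OF tri'] by blast
  moreover have "proportional_sides (f A, f B, f C) (dist A B) (dist B C) (dist C A)"
    unfolding proportional_sides_def using \<alpha> d by (auto intro!: exI[of _ "(cmod \<alpha>)\<^sup>2"])
  ultimately show ?R by blast
next
  assume ?R
  then obtain P Q R where t: "(P, Q, R) \<in> {(A', B', C'), (B', C', A'), (C', A', B')}"
    and p: "proportional_sides (P, Q, R) (dist A B) (dist B C) (dist C A)"
    by (metis prod_cases3)
  have tri'': "anticlockwise P Q R" and hull: "{P, Q, R} = {A', B', C'}"
    using t tri' by (auto simp: anticlockwise_def algebra_simps)
  obtain k where "k > 0" "(dist P Q)\<^sup>2 = k * (dist A B)\<^sup>2" "(dist Q R)\<^sup>2 = k * (dist B C)\<^sup>2"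
      "(dist R P)\<^sup>2 = k * (dist C A)\<^sup>2"
    using p by (auto simp: proportional_sides_def)
  from proportional_sides_imp_similarity[OF tri tri'' this]
  obtain \<alpha> \<beta> where "\<alpha> \<noteq> 0" "P = \<alpha> * A + \<beta>" "Q = \<alpha> * B + \<beta>" "R = \<alpha> * C + \<beta>" .
  then have "(\<lambda>z. \<alpha> * z + \<beta>) ` (convex hull {A, B, C}) = convex hull {P, Q, R}"
    unfolding similarity_image_convex_hull by simp
  with \<open>\<alpha> \<noteq> 0\<close> show ?L
    unfolding similar_def orientation_preserving_similarity_def hull by blast
qed

text \<open>The side vector is, up to sign, q(B - C) + (1 - q)(C - A). As the two differences add up
  to B - A, twice their inner product is the last bracket.\<close>

lemma equisection_side:
  "(dist (q *\<^sub>R B + (1 - q) *\<^sub>R C) (q *\<^sub>R C + (1 - q) *\<^sub>R A))\<^sup>2 =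
    q\<^sup>2 * (dist B C)\<^sup>2 + (1 - q)\<^sup>2 * (dist C A)\<^sup>2
      + q * (1 - q) * ((dist A B)\<^sup>2 - (dist B C)\<^sup>2 - (dist C A)\<^sup>2)"
  for A B C :: complex
  unfolding dist_norm cmod_power2 by (simp add: power2_eq_square algebra_simps)

text \<open>Here \<open>x, y, z\<close> and \<open>X, Y, Z\<close> are the squared sides before and after equisection.\<close>

lemma equisection_sides_proportional_iff:
  fixes x y z q :: real
  assumes pos: "x + y + z > 0" and nz: "x \<noteq> y \<or> y \<noteq> z"
    and X: "X = q\<^sup>2 * y + (1 - q)\<^sup>2 * z + q * (1 - q) * (x - y - z)"
    and Y: "Y = q\<^sup>2 * z + (1 - q)\<^sup>2 * x + q * (1 - q) * (y - z - x)"
    and Z: "Z = q\<^sup>2 * x + (1 - q)\<^sup>2 * y + q * (1 - q) * (z - x - y)"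
  shows "(\<exists>k>0. x = k * X \<and> z = k * Y \<and> y = k * Z) \<longleftrightarrow>
    y + z - 2 * x \<noteq> 0 \<and> q = (z - x) / (y + z - 2 * x)"
    (is "?L \<longleftrightarrow> ?R")
proof -
  define m where "m = 1 - 3 * q + 3 * q\<^sup>2"
  define l where "l = (y + z - 2 * x) * q - (z - x)"
  \<comment> \<open>Positivity follows from m = 3(q - 1/2)^2 + 1/4.\<close>
  have "(q - 1/2)\<^sup>2 \<ge> 0" by simp
  then have m: "m > 0" by (simp add: m_def power2_eq_square algebra_simps)
  have sum: "X + Y + Z = m * (x + y + z)"
    unfolding X Y Z m_def by (simp add: power2_eq_square algebra_simps)
  have factor: "X - m * x = (2 * q - 1) * l" "Y - m * z = (1 - q) * l" "Z - m * y = - q * l"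
    unfolding X Y Z m_def l_def by (simp_all add: power2_eq_square algebra_simps)
  have "?L \<longleftrightarrow> l = 0"
  proof
    assume ?L
    then obtain k where k: "k > 0" "x = k * X" "z = k * Y" "y = k * Z" by blast
    then have "x + y + z = k * (m * (x + y + z))"
      unfolding sum[symmetric] by (simp add: algebra_simps)
    then have "k * m = 1" using pos by simp
    then have "m * z = Y" "m * y = Z"
      using k by (metis mult.assoc mult.commute mult_1)+
    \<comment> \<open>The coefficients 1 - q and q add up to 1, so these two equations already give
      l = 0.\<close>
    with factor have "(1 - q) * l = 0" "q * l = 0" by auto
    then show "l = 0" by (auto simp: algebra_simps)
  next
    assume "l = 0"
    with factor m show ?L by (intro exI[of _ "1 / m"]) (simp add: field_simps)
  qed
  \<comment> \<open>If the denominator vanishes, l = 0 would mean z = x and hence y = x, contrary to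
    \<open>nz\<close>; both sides are then false.\<close>
  also have "\<dots> \<longleftrightarrow> ?R"
    using nz by (cases "y + z - 2 * x = 0") (auto simp: l_def eq_divide_eq mult.commute)
  finally show ?thesis .
qed

theorem lemma6:
  fixes a b q :: real and \<Delta>ab \<Delta>ba :: "complex set"
  assumes "a > 0" and "b > 0" and "(a, b) \<noteq> (1, 1)"
    and "side_lengths_anticlockwise \<Delta>ab 1 a b"
    and "side_lengths_anticlockwise \<Delta>ba 1 b a"
  shows "similarity_class (equisection q \<Delta>ab) = similarity_class \<Delta>ba \<longleftrightarrow>
    (a\<^sup>2 + b\<^sup>2 - 2 \<noteq> 0 \<and> q = (b\<^sup>2 - 1) / (a\<^sup>2 + b\<^sup>2 - 2)) \<or>
    (b\<^sup>2 + 1 - 2 * a\<^sup>2 \<noteq> 0 \<and> q = (1 - a\<^sup>2) / (b\<^sup>2 + 1 - 2 * a\<^sup>2)) \<or>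
    (1 + a\<^sup>2 - 2 * b\<^sup>2 \<noteq> 0 \<and> q = (a\<^sup>2 - b\<^sup>2) / (1 + a\<^sup>2 - 2 * b\<^sup>2))"
    (is "_ \<longleftrightarrow> ?rhs")
proof -
  obtain A B C where ab: "anticlockwise A B C" "\<Delta>ab = convex hull {A, B, C}"
    and dab: "dist A B = 1" "dist B C = a" "dist C A = b"
    using assms(4) unfolding side_lengths_anticlockwise_def by blast
  obtain A' B' C' where ba: "anticlockwise A' B' C'" "\<Delta>ba = convex hull {A', B', C'}"
    and dba: "dist A' B' = 1" "dist B' C' = b" "dist C' A' = a"
    using assms(5) unfolding side_lengths_anticlockwise_def by blast
  define P Q R where PQR: "P = q *\<^sub>R B + (1 - q) *\<^sub>R C" "Q = q *\<^sub>R C + (1 - q) *\<^sub>R A"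
    "R = q *\<^sub>R A + (1 - q) *\<^sub>R B"
  have T: "anticlockwise P Q R" "equisection q \<Delta>ab = convex hull {P, Q, R}"
    using ab anticlockwise_equisection equisection_convex_hull by (simp_all add: PQR)
  have X: "(dist P Q)\<^sup>2 = q\<^sup>2 * a\<^sup>2 + (1 - q)\<^sup>2 * b\<^sup>2 + q * (1 - q) * (1 - a\<^sup>2 - b\<^sup>2)"
    and Y: "(dist Q R)\<^sup>2 = q\<^sup>2 * b\<^sup>2 + (1 - q)\<^sup>2 * 1 + q * (1 - q) * (a\<^sup>2 - b\<^sup>2 - 1)"
    and Z: "(dist R P)\<^sup>2 = q\<^sup>2 * 1 + (1 - q)\<^sup>2 * a\<^sup>2 + q * (1 - q) * (b\<^sup>2 - 1 - a\<^sup>2)"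
    unfolding PQR equisection_side dab by simp_all
  \<comment> \<open>Positivity of \<open>a\<close> and \<open>b\<close> turns the hypothesis into
    one on squares: the triangle is not equilateral.\<close>
  have "\<not> (a\<^sup>2 = 1 \<and> b\<^sup>2 = 1)"
    using assms(1-3) by (auto simp: power2_eq_1_iff)
  then have nz: "1 \<noteq> a\<^sup>2 \<or> a\<^sup>2 \<noteq> b\<^sup>2" "a\<^sup>2 \<noteq> b\<^sup>2 \<or> b\<^sup>2 \<noteq> 1" "b\<^sup>2 \<noteq> 1 \<or> 1 \<noteq> a\<^sup>2"
    by auto
  have pos: "1 + a\<^sup>2 + b\<^sup>2 > 0" "a\<^sup>2 + b\<^sup>2 + 1 > 0" "b\<^sup>2 + 1 + a\<^sup>2 > 0"
    using zero_le_power2[of a] zero_le_power2[of b] by linarith+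
  have "similarity_class (equisection q \<Delta>ab) = similarity_class \<Delta>ba \<longleftrightarrow>
      similar (equisection q \<Delta>ab) \<Delta>ba"
    using ba anticlockwise_is_triangle similarity_class_eq_iff by blast
  \<comment> \<open>The disjuncts match \<open>P, Q, R\<close> with the three cyclic listings of
    \<open>A', B', C'\<close>. Their conjuncts are ordered so that each is the same criterion with
    the sides rotated cyclically.\<close>
  also have "\<dots> \<longleftrightarrow>
      (\<exists>k>0. 1 = k * (dist P Q)\<^sup>2 \<and> b\<^sup>2 = k * (dist Q R)\<^sup>2 \<and> a\<^sup>2 = k * (dist R P)\<^sup>2) \<or>
      (\<exists>k>0. a\<^sup>2 = k * (dist Q R)\<^sup>2 \<and> 1 = k * (dist R P)\<^sup>2 \<and> b\<^sup>2 = k * (dist P Q)\<^sup>2) \<or>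
      (\<exists>k>0. b\<^sup>2 = k * (dist R P)\<^sup>2 \<and> a\<^sup>2 = k * (dist P Q)\<^sup>2 \<and> 1 = k * (dist Q R)\<^sup>2)"
    unfolding T(2) ba(2) similar_iff_proportional_sides[OF T(1) ba(1)] proportional_sides_def
    by (auto simp: dba)
  also have "\<dots> \<longleftrightarrow> ?rhs"
    by (simp only: equisection_sides_proportional_iff[OF pos(1) nz(1) X Y Z]
        equisection_sides_proportional_iff[OF pos(2) nz(2) Y Z X]
        equisection_sides_proportional_iff[OF pos(3) nz(3) Z X Y] mult_1_right)
  finally show ?thesis .
qed

end
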